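(* Let $U$ be a finite nonempty set, $k, m \in \mathbb{N}$ (with $k,m\ge 1$), $\mathbf{V} = (V_1,\ldots,V_k) \in (k+1)^U$. Let $g : (k+1)^U \to \mathbb{R}$ be $k$-submodular and monotonically non-decreasing with $g(\emptyset) \ge 0$, and let $c$ be a non-negative modular function with $c(\emptyset) = 0$. Let $$\mathbf{OPT} \in \operatorname{arg\,max}_{\mathbf{S} \preceq \mathbf{V};\ |\mathrm{supp}(\mathbf{S})| \le m} \big( g(\mathbf{S}) - c(\mathbf{S}) \big),$$ and let $\mathbf{S}_m = (S_{m,1},\ldots,S_{m,k})$ be the output of the generalized distorted greedy algorithm run with $g, c, m, U, \mathbf{V}$. Then $$g(\mathbf{S}_m) - c(\mathbf{S}_m) \ge (1 - e^{-1})\, g(\mathbf{OPT}) - c(\mathbf{OPT}).$$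
   Context: $(k+1)^U$ denotes the set of $k$-tuples $\mathbf{S} = (S_1,\ldots,S_k)$ of pairwise disjoint subsets of $U$; $\emptyset$ also denotes the tuple of empty sets; $\mathrm{supp}(\mathbf{S}) = \bigcup_{i} S_i$; $\mathbf{S} \preceq \mathbf{T}$ means $S_i \subseteq T_i$ for all $i$. $g$ is monotonically non-decreasing if $g(\mathbf{S}) \le g(\mathbf{T})$ whenever $\mathbf{S} \preceq \mathbf{T}$. $g$ is $k$-submodular if $g(\mathbf{S}) + g(\mathbf{T}) \ge g(\mathbf{S} \sqcap \mathbf{T}) + g(\mathbf{S} \sqcup \mathbf{T})$ for all $\mathbf{S},\mathbf{T}$, where the $i$-th set of $\mathbf{S}\sqcap\mathbf{T}$ is $S_i \cap T_i$ and the $i$-th set of $\mathbf{S}\sqcup\mathbf{T}$ is $(S_i \cup T_i)\setminus \bigcup_{j\ne i}(S_j\cup T_j)$. The marginal gain is $\Delta_{e,j} g(\mathbf{S}) = g(S_1,\ldots,S_j\cup\{e\},\ldots,S_k) - g(\mathbf{S})$. A modular $c$ with $c(\emptyset)=0$ on the ground set $U$ is $c(\mathbf{S}) = \sum_{e \in \mathrm{supp}(\mathbf{S})} c(\{e\})$, and non-negativity means $c(\{e\}) \ge 0$ for all $e\in U$. Generalized distorted greedy algorithm: set $\mathbf{S}_0 = \emptyset$. For $i = 0,\ldots,m-1$: choose $$(j^*,e^* ) \in \operatorname{arg\,max}_{j \in \{1,\ldots,k\},\ e \in V_j \setminus S_{i,j}} \Big\{ (1-\tfrac1m)^{m-(i+1)}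 \Delta_{e,j} g(\mathbf{S}_i) - c(\{e\}) \Big\}$$ (ties broken arbitrarily). If the maximal value is $>0$, set $S_{i+1,j^*} = S_{i,j^*}\cup\{e^*\}$ and $S_{i+1,l} = S_{i,l}$ for $l\ne j^*$; otherwise set $\mathbf{S}_{i+1} = \mathbf{S}_i$. If there is no pair $(j,e)$ to maximize over, $\mathbf{S}_{i+1}=\mathbf{S}_i$. Output $\mathbf{S}_m$. The convention $0^0 = 1$ is used when $m=1$. *)

theory Defs
  imports Complex_Main "HOL-Library.Disjoint_Sets"
begin

text \<open>
  A \<open>k\<close>-tuple \<open>(S\<^sub>1, \<dots>, S\<^sub>k)\<close> of sets is a function on \<open>nat\<close> whose components outside
  \<open>{1..k}\<close> are normalised to \<open>{}\<close>, so that each tuple has exactly one representative and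
  \<open>\<lambda>_. {}\<close> is the tuple of empty sets.
\<close>

definition ktuples :: "nat \<Rightarrow> 'a set \<Rightarrow> (nat \<Rightarrow> 'a set) set" where
  "ktuples k U = {S. (\<forall>i\<in>{1..k}. S i \<subseteq> U) \<and> disjoint_family_on S {1..k} \<and>
                     (\<forall>i. i \<notin> {1..k} \<longrightarrow> S i = {})}"

definition empty_ktuple :: "nat \<Rightarrow> 'a set" where
  "empty_ktuple = (\<lambda>_. {})"

definition supp :: "nat \<Rightarrow> (nat \<Rightarrow> 'a set) \<Rightarrow> 'a set" where
  "supp k S = (\<Union>i\<in>{1..k}. S i)"

definition ktuple_le :: "nat \<Rightarrow> (nat \<Rightarrow> 'a set) \<Rightarrow> (nat \<Rightarrow> 'a set) \<Rightarrow> bool" where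
  "ktuple_le k S T \<longleftrightarrow> (\<forall>i\<in>{1..k}. S i \<subseteq> T i)"

definition ktuple_meet :: "(nat \<Rightarrow> 'a set) \<Rightarrow> (nat \<Rightarrow> 'a set) \<Rightarrow> nat \<Rightarrow> 'a set" where
  "ktuple_meet S T = (\<lambda>i. S i \<inter> T i)"

definition ktuple_join :: "nat \<Rightarrow> (nat \<Rightarrow> 'a set) \<Rightarrow> (nat \<Rightarrow> 'a set) \<Rightarrow> nat \<Rightarrow> 'a set" where
  "ktuple_join k S T = (\<lambda>i. (S i \<union> T i) - (\<Union>j\<in>{1..k} - {i}. S j \<union> T j))"

definition k_monotone :: "nat \<Rightarrow> 'a set \<Rightarrow> ((nat \<Rightarrow> 'a set) \<Rightarrow> real) \<Rightarrow> bool" where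
  "k_monotone k U g \<longleftrightarrow>
     (\<forall>S\<in>ktuples k U. \<forall>T\<in>ktuples k U. ktuple_le k S T \<longrightarrow> g S \<le> g T)"

definition k_submodular :: "nat \<Rightarrow> 'a set \<Rightarrow> ((nat \<Rightarrow> 'a set) \<Rightarrow> real) \<Rightarrow> bool" where
  "k_submodular k U g \<longleftrightarrow>
     (\<forall>S\<in>ktuples k U. \<forall>T\<in>ktuples k U.
        g S + g T \<ge> g (ktuple_meet S T) + g (ktuple_join k S T))"

definition marginal_gain ::
    "((nat \<Rightarrow> 'a set) \<Rightarrow> real) \<Rightarrow> 'a \<Rightarrow> nat \<Rightarrow> (nat \<Rightarrow> 'a set) \<Rightarrow> real" where
  "marginal_gain g e j S = g (S(j := S j \<union> {e})) - g S"

text \<open>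
  The cost \<open>c\<close> is a function on subsets of \<open>U\<close>; its value at a tuple \<open>S\<close> is its value at the
  support, \<open>c (supp k S)\<close>.
\<close>

definition normalized_modular :: "'a set \<Rightarrow> ('a set \<Rightarrow> real) \<Rightarrow> bool" where
  "normalized_modular U c \<longleftrightarrow> c {} = 0 \<and> (\<forall>A. A \<subseteq> U \<longrightarrow> c A = (\<Sum>e\<in>A. c {e}))"

definition ktuple_cost :: "nat \<Rightarrow> ('a set \<Rightarrow> real) \<Rightarrow> (nat \<Rightarrow> 'a set) \<Rightarrow> real" where
  "ktuple_cost k c S = c (supp k S)"

definition greedy_candidates ::
    "nat \<Rightarrow> (nat \<Rightarrow> 'a set) \<Rightarrow> (nat \<Rightarrow> 'a set) \<Rightarrow> (nat \<times> 'a) set" where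
  "greedy_candidates k V S = {(j, e). j \<in> {1..k} \<and> e \<in> V j - S j}"

definition distorted_gain ::
    "((nat \<Rightarrow> 'a set) \<Rightarrow> real) \<Rightarrow> ('a set \<Rightarrow> real) \<Rightarrow> nat \<Rightarrow> nat \<Rightarrow> (nat \<Rightarrow> 'a set) \<Rightarrow> nat \<times> 'a \<Rightarrow> real"
  where
  "distorted_gain g c m i S = (\<lambda>(j, e).
     (1 - 1 / real m) ^ (m - (i + 1)) * marginal_gain g e j S - c {e})"

text \<open>
  Ties are broken arbitrarily, so an iteration is a relation between the current tuple \<open>S\<close> and
  the next tuple \<open>S'\<close>, and a run is any sequence of iterates compatible with it.
\<close>

definition distorted_greedy_step ::
    "nat \<Rightarrow> nat \<Rightarrow> ((nat \<Rightarrow> 'a set) \<Rightarrow> real) \<Rightarrow> ('a set \<Rightarrow> real) \<Rightarrow> (nat \<Rightarrow> 'a set) \<Rightarrow>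
     nat \<Rightarrow> (nat \<Rightarrow> 'a set) \<Rightarrow> (nat \<Rightarrow> 'a set) \<Rightarrow> bool" where
  "distorted_greedy_step k m g c V i S S' \<longleftrightarrow>
     (if greedy_candidates k V S = {} then S' = S
      else \<exists>j e. is_arg_max (distorted_gain g c m i S) (\<lambda>p. p \<in> greedy_candidates k V S) (j, e) \<and>
             S' = (if distorted_gain g c m i S (j, e) > 0 then S(j := S j \<union> {e}) else S))"

definition distorted_greedy_run ::
    "nat \<Rightarrow> nat \<Rightarrow> ((nat \<Rightarrow> 'a set) \<Rightarrow> real) \<Rightarrow> ('a set \<Rightarrow> real) \<Rightarrow> (nat \<Rightarrow> 'a set) \<Rightarrow>
     (nat \<Rightarrow> nat \<Rightarrow> 'a set) \<Rightarrow> bool" where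
  "distorted_greedy_run k m g c V S \<longleftrightarrow>
     S 0 = empty_ktuple \<and> (\<forall>i<m. distorted_greedy_step k m g c V i (S i) (S (i + 1)))"

end

theory Submission
  imports Defs
begin

text \<open>
  Since the components of \<open>V\<close> are disjoint, a tuple below \<open>V\<close> is determined by its support, and
  on supports meet and join become intersection and union: below \<open>V\<close> the function \<open>g\<close> is
  an ordinary monotone submodular set function \<open>f\<close>. Put \<open>p = 1 - 1/m\<close>. If \<open>A\<close> is the support
  after \<open>i\<close> iterations and \<open>B\<close> that of the optimum, then averaging the distorted gains over the
  at most \<open>m\<close> elements of \<open>B - A\<close> shows that the next iteration increases the potential
  \<open>p ^ (m - i) * f A - c A\<close> by at least \<open>(p ^ (m - i - 1) * f B - c B) / m\<close>. Summing the geometric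
  series yields the factor \<open>1 - p ^ m \<ge> 1 - 1/e\<close>.
\<close>

definition restrict_ktuple :: "(nat \<Rightarrow> 'a set) \<Rightarrow> 'a set \<Rightarrow> nat \<Rightarrow> 'a set" where
  "restrict_ktuple V A = (\<lambda>i. V i \<inter> A)"

lemma restrict_ktuple_in_ktuples:
  assumes "V \<in> ktuples k U"
  shows "restrict_ktuple V A \<in> ktuples k U"
  using assms unfolding ktuples_def restrict_ktuple_def disjoint_family_on_def by blast

lemma restrict_ktuple_empty: "restrict_ktuple V {} = empty_ktuple"
  by (simp add: restrict_ktuple_def empty_ktuple_def)

lemma supp_subset: "V \<in> ktuples k U \<Longrightarrow> supp k V \<subseteq> U"
  by (auto simp: ktuples_def supp_def)

lemma supp_restrict_ktuple: "A \<subseteq> supp k V \<Longrightarrow> supp k (restrict_ktuple V A) = A"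
  by (auto simp: supp_def restrict_ktuple_def)

lemma disjoint_components:
  assumes "V \<in> ktuples k U" "e \<in> V i" "e \<in> V j"
  shows "i = j"
proof -
  have "i \<in> {1..k}" "j \<in> {1..k}" using assms by (auto simp: ktuples_def)
  then show ?thesis using assms unfolding ktuples_def disjoint_family_on_def by blast
qed

lemma ktuple_eq_restrict_ktuple:
  assumes V: "V \<in> ktuples k U" and T: "T \<in> ktuples k U" and le: "ktuple_le k T V"
  shows "T = restrict_ktuple V (supp k T)"
proof
  fix i
  show "T i = restrict_ktuple V (supp k T) i"
  proof (cases "i \<in> {1..k}")
    case True
    then have "T i \<subseteq> V i" using le by (simp add: ktuple_le_def)
    \<comment> \<open>An element of \<open>V i\<close> in the support of \<open>T\<close> cannot sit
      in another component of \<open>T\<close>, since it would then lie in two components of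
      \<open>V\<close>.\<close>
    moreover have "e \<in> T i" if "e \<in> V i" "j \<in> {1..k}" "e \<in> T j" for e j
    proof -
      have "e \<in> V j" using le that by (auto simp: ktuple_le_def)
      then show ?thesis using disjoint_components[OF V that(1)] that(3) by simp
    qed
    ultimately show ?thesis using True by (auto simp: restrict_ktuple_def supp_def)
  next
    case False
    then have "T i = {}" "V i = {}" using T V unfolding ktuples_def by blast+
    then show ?thesis by (simp add: restrict_ktuple_def)
  qed
qed

lemma restrict_ktuple_insert:
  assumes V: "V \<in> ktuples k U" and e: "e \<in> V j"
  shows "(restrict_ktuple V A)(j := restrict_ktuple V A j \<union> {e}) = restrict_ktuple V (insert e A)"
proof -
  have "e \<in> V i \<longleftrightarrow> i = j" for i
    using e disjoint_components[OF V e] by blast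
  then show ?thesis by (auto simp: restrict_ktuple_def fun_eq_iff)
qed

lemma ktuple_meet_restrict_ktuple:
  "ktuple_meet (restrict_ktuple V A) (restrict_ktuple V B) = restrict_ktuple V (A \<inter> B)"
  by (auto simp: ktuple_meet_def restrict_ktuple_def)

text \<open>The join deletes elements that the two tuples place in different components. Below a
  common \<open>V\<close> no such conflict arises.\<close>

lemma ktuple_join_restrict_ktuple:
  assumes "V \<in> ktuples k U"
  shows "ktuple_join k (restrict_ktuple V A) (restrict_ktuple V B) = restrict_ktuple V (A \<union> B)"
proof
  fix i
  have "V i \<inter> V j = {}" if "j \<noteq> i" for j
    using disjoint_components[OF assms] that by blast
  then show "ktuple_join k (restrict_ktuple V A) (restrict_ktuple V B) i =
      restrict_ktuple V (A \<union> B) i"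
    unfolding ktuple_join_def restrict_ktuple_def by blast
qed

lemma restrict_ktuple_mono:
  assumes "V \<in> ktuples k U" "k_monotone k U g" "A \<subseteq> B"
  shows "g (restrict_ktuple V A) \<le> g (restrict_ktuple V B)"
proof -
  have "ktuple_le k (restrict_ktuple V A) (restrict_ktuple V B)"
    using assms(3) by (auto simp: ktuple_le_def restrict_ktuple_def)
  then show ?thesis
    using assms(2) restrict_ktuple_in_ktuples[OF assms(1)] unfolding k_monotone_def by blast
qed

lemma restrict_ktuple_submodular:
  assumes "V \<in> ktuples k U" "k_submodular k U g"
  shows "g (restrict_ktuple V (A \<inter> B)) + g (restrict_ktuple V (A \<union> B))
    \<le> g (restrict_ktuple V A) + g (restrict_ktuple V B)"
proof -
  have "g (ktuple_meet (restrict_ktuple V A) (restrict_ktuple V B)) +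
      g (ktuple_join k (restrict_ktuple V A) (restrict_ktuple V B))
    \<le> g (restrict_ktuple V A) + g (restrict_ktuple V B)"
    using assms(2) restrict_ktuple_in_ktuples[OF assms(1)] unfolding k_submodular_def by blast
  then show ?thesis
    by (simp add: ktuple_meet_restrict_ktuple ktuple_join_restrict_ktuple[OF assms(1)])
qed

text \<open>The elements of \<open>B\<close> are added one at a time. Submodularity for
  \<open>A \<union> B\<close> and \<open>insert x A\<close>, which meet in \<open>A\<close>, bounds
  the gain of \<open>x\<close> over \<open>A \<union> B\<close> by its gain over
  \<open>A\<close>.\<close>

lemma submodular_union_le_sum:
  fixes f :: "'a set \<Rightarrow> real"
  assumes sub: "\<And>A B. f (A \<inter> B) + f (A \<union> B) \<le> f A + f B"
    and "finite B" "A \<inter> B = {}"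
  shows "f (A \<union> B) - f A \<le> (\<Sum>e\<in>B. f (insert e A) - f A)"
  using assms(2,3)
proof (induction B)
  case (insert x B)
  have "(A \<union> B) \<inter> insert x A = A" "(A \<union> B) \<union> insert x A = A \<union> insert x B"
    using insert by auto
  then have "f A + f (A \<union> insert x B) \<le> f (A \<union> B) + f (insert x A)"
    using sub[of "A \<union> B" "insert x A"] by simp
  moreover have "f (A \<union> B) - f A \<le> (\<Sum>e\<in>B. f (insert e A) - f A)"
    using insert by auto
  ultimately show ?case using insert by simp
qed simp

lemma distorted_gain_restrict_ktuple:
  assumes "V \<in> ktuples k U" "e \<in> V j"
  shows "distorted_gain g c m i (restrict_ktuple V A) (j, e) =
    (1 - 1 / real m) ^ (m - Suc i) *
      (g (restrict_ktuple V (insert e A)) - g (restrict_ktuple V A)) - c {e}"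
  using restrict_ktuple_insert[OF assms] by (simp add: distorted_gain_def marginal_gain_def)

lemma normalized_modular_insert:
  assumes "normalized_modular U c" "finite U" "insert e A \<subseteq> U" "e \<notin> A"
  shows "c (insert e A) = c A + c {e}"
proof -
  have "finite A" using assms(2,3) by (auto intro: finite_subset)
  moreover have "c (insert e A) = (\<Sum>e\<in>insert e A. c {e})" "c A = (\<Sum>e\<in>A. c {e})"
    using assms(1,3) by (simp_all add: normalized_modular_def)
  ultimately show ?thesis using assms(4) by simp
qed

text \<open>Here \<delta> is the positive part of the largest distorted gain, or 0 without
  candidates. This treats iterations that add an element and those that add none alike.\<close>

lemma distorted_greedy_step_gain:
  fixes g :: "(nat \<Rightarrow> 'a set) \<Rightarrow> real" and c :: "'a set \<Rightarrow> real" and V :: "nat \<Rightarrow> 'a set"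
    and m i :: nat
  defines "f \<equiv> \<lambda>A. g (restrict_ktuple V A)" and "q \<equiv> (1 - 1 / real m) ^ (m - Suc i)"
  assumes V: "V \<in> ktuples k U" and U: "finite U" and c: "normalized_modular U c"
    and A: "A \<subseteq> supp k V"
    and step: "distorted_greedy_step k m g c V i (restrict_ktuple V A) S'"
  obtains A' \<delta> where "A' \<subseteq> supp k V" "S' = restrict_ktuple V A'" "\<delta> \<ge> 0"
    "\<And>e. e \<in> supp k V - A \<Longrightarrow> q * (f (insert e A) - f A) - c {e} \<le> \<delta>"
    "q * f A' - c A' = q * f A - c A + \<delta>"
proof -
  let ?R = "restrict_ktuple V A"
  let ?C = "greedy_candidates k V ?R"
  let ?G = "distorted_gain g c m i ?R"
  have gain: "?G (j, e) = q * (f (insert e A) - f A) - c {e}" if "e \<in> V j" for j e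
    unfolding f_def q_def by (rule distorted_gain_restrict_ktuple[OF V that])
  have cand: "\<exists>j. (j, e) \<in> ?C \<and> e \<in> V j" if "e \<in> supp k V - A" for e
    using that by (auto simp: supp_def greedy_candidates_def restrict_ktuple_def)
  show ?thesis
  proof (cases "?C = {}")
    case True
    then have "S' = ?R" using step by (simp add: distorted_greedy_step_def)
    moreover have "supp k V - A = {}" using cand True by blast
    ultimately show ?thesis by (intro that[of A 0]) (use A in auto)
  next
    case False
    then obtain j e where max: "is_arg_max ?G (\<lambda>p. p \<in> ?C) (j, e)"
      and S': "S' = (if ?G (j, e) > 0 then ?R(j := ?R j \<union> {e}) else ?R)"
      using step unfolding distorted_greedy_step_def by auto
    have je: "j \<in> {1..k}" "e \<in> V j" "e \<notin> A" and le: "\<And>p. p \<in> ?C \<Longrightarrow> ?G p \<le> ?G (j, e)"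
      using max by (auto simp: is_arg_max_def greedy_candidates_def restrict_ktuple_def not_less)
    have bound: "q * (f (insert x A) - f A) - c {x} \<le> ?G (j, e)"
      if x: "x \<in> supp k V - A" for x
    proof -
      obtain l where "(l, x) \<in> ?C" "x \<in> V l" using cand[OF x] by blast
      then show ?thesis using le[of "(l, x)"] gain[of x l] by simp
    qed
    show ?thesis
    proof (cases "?G (j, e) > 0")
      case True
      have sub: "insert e A \<subseteq> supp k V" using A je by (auto simp: supp_def)
      then have "c (insert e A) = c A + c {e}"
        using normalized_modular_insert[OF c U _ je(3)] supp_subset[OF V] by (meson order.trans)
      moreover have "S' = restrict_ktuple V (insert e A)"
        using S' True restrict_ktuple_insert[OF V je(2)] by simp
      ultimately show ?thesis
        using sub True gain[OF je(2)]
        \<comment> \<open>Unification with \<open>bound\<close> instantiates \<delta> to the maximal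
          distorted gain.\<close>
        by (intro that[OF _ _ _ bound, where A' = "insert e A"]) (simp_all add: right_diff_distrib)
    next
      case False
      then have "q * (f (insert x A) - f A) - c {x} \<le> 0" if "x \<in> supp k V - A" for x
        using bound[OF that] by linarith
      then show ?thesis
        using A S' False by (intro that[of A 0]) simp_all
    qed
  qed
qed

text \<open>By submodularity the gain from \<open>A\<close> to \<open>A \<union> B\<close> is at
  most the sum of the single gains over \<open>B - A\<close>. Each of these at most \<open>m\<close>
  elements has distorted gain at most \<delta>.\<close>

lemma submodular_distorted_gain_bound:
  fixes f c :: "'a set \<Rightarrow> real"
  assumes sub: "\<And>A B. f (A \<inter> B) + f (A \<union> B) \<le> f A + f B"
    and mono: "\<And>A B. A \<subseteq> B \<Longrightarrow> f A \<le> f B"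
    and q: "q \<ge> 0" and \<delta>: "\<delta> \<ge> 0"
    and bound: "\<And>e. e \<in> B - A \<Longrightarrow> q * (f (insert e A) - f A) - c {e} \<le> \<delta>"
    and c: "normalized_modular U c" "\<And>e. e \<in> U \<Longrightarrow> c {e} \<ge> 0"
    and B: "finite B" "B \<subseteq> U" "card B \<le> m"
  shows "q * (f B - f A) - c B \<le> real m * \<delta>"
proof -
  have "f B - f A \<le> f (A \<union> (B - A)) - f A"
    using mono[of B "A \<union> (B - A)"] by auto
  also have "\<dots> \<le> (\<Sum>e\<in>B - A. f (insert e A) - f A)"
    using submodular_union_le_sum[where f = f, OF sub] B by blast
  finally have "q * (f B - f A) \<le> (\<Sum>e\<in>B - A. q * (f (insert e A) - f A))"
    unfolding sum_distrib_left[symmetric] by (rule mult_left_mono[OF _ q])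
  also have "\<dots> \<le> (\<Sum>e\<in>B - A. \<delta> + c {e})"
    using bound by (intro sum_mono) (simp add: algebra_simps)
  \<comment> \<open>Non-negative costs and \<delta> allow the sum to be extended over
    \<open>A \<inter> B\<close>, which produces the full cost of \<open>B\<close>.\<close>
  also have "\<dots> \<le> (\<Sum>e\<in>B. \<delta> + c {e})"
    using B c(2) \<delta> by (intro sum_mono2) (auto intro: add_nonneg_nonneg)
  also have "\<dots> = real (card B) * \<delta> + c B"
    using c(1) B by (simp add: sum.distrib normalized_modular_def)
  also have "\<dots> \<le> real m * \<delta> + c B"
    using B \<delta> by (simp add: mult_right_mono)
  finally show ?thesis by simp
qed

text \<open>Iteration \<open>t\<close> contributes \<open>(p ^ (m - t - 1) * f B - c B) / m\<close>.
  As \<open>1 / m = 1 - p\<close>, the powers telescope to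
  \<open>p ^ (m - i) - p ^ m\<close>.\<close>

lemma distorted_greedy_run_potential:
  fixes g :: "(nat \<Rightarrow> 'a set) \<Rightarrow> real" and c :: "'a set \<Rightarrow> real" and V :: "nat \<Rightarrow> 'a set"
    and m :: nat
  defines "f \<equiv> \<lambda>A. g (restrict_ktuple V A)" and "p \<equiv> 1 - 1 / real m"
  assumes V: "V \<in> ktuples k U" and U: "finite U"
    and sub: "k_submodular k U g" and mono: "k_monotone k U g"
    and c: "normalized_modular U c" "\<And>e. e \<in> U \<Longrightarrow> c {e} \<ge> 0"
    and B: "B \<subseteq> supp k V" "card B \<le> m"
    and run: "distorted_greedy_run k m g c V S" and "i \<le> m"
  shows "\<exists>A\<subseteq>supp k V. S i = restrict_ktuple V A \<and>
    p ^ (m - i) * f A - c A \<ge> p ^ m * f {} + (p ^ (m - i) - p ^ m) * f B - real i / real m * c B"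
  using \<open>i \<le> m\<close>
proof (induction i)
  case 0
  show ?case
    using run c(1)
    by (intro exI[of _ "{}"])
      (simp add: distorted_greedy_run_def restrict_ktuple_empty normalized_modular_def)
next
  case (Suc i)
  then obtain A where A: "A \<subseteq> supp k V" "S i = restrict_ktuple V A"
    and IH: "p ^ (m - i) * f A - c A \<ge>
      p ^ m * f {} + (p ^ (m - i) - p ^ m) * f B - real i / real m * c B"
    by auto
  have m: "m \<ge> 1" using Suc by simp
  define q where "q = p ^ (m - Suc i)"
  \<comment> \<open>For \<open>m = 1\<close> the base \<open>p\<close> is 0 and the exponent is 0,
    so that \<open>q\<close> is 1.\<close>
  have q: "q \<ge> 0" unfolding q_def p_def using m by (intro zero_le_power) simp
  have "m - i = Suc (m - Suc i)" using Suc.prems by simp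
  then have pq: "p ^ (m - i) = q - q / real m"
    by (simp add: q_def p_def algebra_simps)
  have "distorted_greedy_step k m g c V i (restrict_ktuple V A) (S (Suc i))"
    using run Suc.prems by (simp add: distorted_greedy_run_def flip: A(2))
  then obtain A' \<delta> where A': "A' \<subseteq> supp k V" "S (Suc i) = restrict_ktuple V A'" and \<delta>: "\<delta> \<ge> 0"
    and bound: "\<And>e. e \<in> supp k V - A \<Longrightarrow> q * (f (insert e A) - f A) - c {e} \<le> \<delta>"
    and step: "q * f A' - c A' = q * f A - c A + \<delta>"
    unfolding q_def p_def f_def
    by (rule distorted_greedy_step_gain[OF V U c(1) A(1)]) (rule that[unfolded q_def p_def f_def])
  have BU: "B \<subseteq> U" using B supp_subset[OF V] by auto
  have "q * (f B - f A) - c B \<le> real m * \<delta>"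
  proof (rule submodular_distorted_gain_bound[OF _ _ q \<delta> _ c _ BU B(2)])
    show "f (X \<inter> Y) + f (X \<union> Y) \<le> f X + f Y" for X Y
      unfolding f_def by (rule restrict_ktuple_submodular[OF V sub])
    show "f X \<le> f Y" if "X \<subseteq> Y" for X Y
      unfolding f_def by (rule restrict_ktuple_mono[OF V mono that])
    show "finite B" using BU U finite_subset by blast
  qed (use bound B in auto)
  then have "(q * (f B - f A) - c B) / real m \<le> \<delta>"
    using m by (simp add: field_simps)
  \<comment> \<open>Raising the weight of \<open>f A\<close> from \<open>p ^ (m - i)\<close> to
    \<open>q\<close> gains \<open>q * f A / m\<close>, which cancels the term
    \<open>- q * f A / m\<close> of the averaged bound.\<close>
  then have "q * f A' - c A' \<ge> p ^ (m - i) * f A - c A + (q * f B - c B) / real m"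
    unfolding step pq by (simp add: algebra_simps diff_divide_distrib add_divide_distrib)
  then have "q * f A' - c A' \<ge> p ^ m * f {} + (q - p ^ m) * f B - real (Suc i) / real m * c B"
    using IH unfolding pq by (simp add: algebra_simps diff_divide_distrib add_divide_distrib)
  then show ?case using A' unfolding q_def by blast
qed

theorem theorem2p13:
  fixes U :: "'a set" and k m :: nat and V OPT :: "nat \<Rightarrow> 'a set"
    and g :: "(nat \<Rightarrow> 'a set) \<Rightarrow> real" and c :: "'a set \<Rightarrow> real"
    and S :: "nat \<Rightarrow> nat \<Rightarrow> 'a set"
  assumes "finite U" and "U \<noteq> {}"
    and "k \<ge> 1" and "m \<ge> 1"
    and "V \<in> ktuples k U"
    and "k_submodular k U g" and "k_monotone k U g" and "g empty_ktuple \<ge> 0"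
    and "normalized_modular U c" and "\<And>e. e \<in> U \<Longrightarrow> c {e} \<ge> 0"
    and "is_arg_max (\<lambda>T. g T - ktuple_cost k c T)
           (\<lambda>T. T \<in> ktuples k U \<and> ktuple_le k T V \<and> card (supp k T) \<le> m) OPT"
    and "distorted_greedy_run k m g c V S"
  shows "g (S m) - ktuple_cost k c (S m) \<ge> (1 - exp (-1)) * g OPT - ktuple_cost k c OPT"
proof -
  let ?f = "\<lambda>A. g (restrict_ktuple V A)"
  let ?p = "1 - 1 / real m"
  let ?B = "supp k OPT"
  note V = assms(5)
  have OPT: "OPT \<in> ktuples k U" "ktuple_le k OPT V" "card ?B \<le> m"
    using assms(11) by (auto simp: is_arg_max_def)
  have fB: "?f ?B = g OPT"
    using ktuple_eq_restrict_ktuple[OF V OPT(1,2)] by simp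
  have "?B \<subseteq> supp k V" using OPT(2) by (auto simp: supp_def ktuple_le_def)
  \<comment> \<open>After \<open>m\<close> iterations the weight is \<open>p ^ 0 = 1\<close>, so the
    potential is the undistorted objective.\<close>
  then obtain A where A: "A \<subseteq> supp k V" "S m = restrict_ktuple V A"
    and pot: "?f A - c A \<ge> ?p ^ m * ?f {} + (1 - ?p ^ m) * ?f ?B - c ?B"
    using distorted_greedy_run_potential[OF V assms(1,6,7,9,10) _ OPT(3) assms(12) order.refl]
      assms(4) by auto
  \<comment> \<open>Replacing \<open>?p ^ m\<close> by its upper bound \<open>exp (-1)\<close>
    weakens the estimate only because \<open>g OPT\<close> is non-negative.\<close>
  have f0: "0 \<le> ?f {}" using assms(8) by (simp add: restrict_ktuple_empty)
  also have "\<dots> \<le> ?f ?B" by (rule restrict_ktuple_mono[OF V assms(7)]) simp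
  finally have "0 \<le> g OPT" by (simp add: fB)
  moreover have "?p ^ m \<le> exp (-1)"
    using exp_ge_one_minus_x_over_n_power_n[of 1 m] assms(4) by simp
  ultimately have "(1 - exp (-1)) * g OPT \<le> (1 - ?p ^ m) * g OPT"
    by (simp add: mult_right_mono)
  moreover have "0 \<le> ?p ^ m * ?f {}"
    using f0 assms(4) by (intro mult_nonneg_nonneg zero_le_power) simp_all
  ultimately show ?thesis
    using pot by (simp add: A(2) ktuple_cost_def supp_restrict_ktuple[OF A(1)] fB)
qed

end
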